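(* Let $X$ be a topological space, $\varphi\colon X\to X$ a self-map, $F$ the set of fixed points of $\varphi$, and $f\colon X\to\mathbb{R}$ a Lyapunov function for $\varphi$. Let $a<b$ be real numbers such that $(f,\varphi)$ satisfies condition (D) on $f^{-1}[a,b]$. Suppose that $f(F)\cap\,]a,b]=\{d_1,\dots,d_m\}$ is a finite set. Then $$\nu(f^a,f^a)+\sum_{i=1}^m\nu\bigl(F\cap f^{-1}(d_i)\bigr)\ \ge\ \nu(f^b,f^a)$$ for any $(\varphi,f^a)$-supervariant index function $\nu$ on $X$.
   Context: All spaces are Hausdorff, all maps and functions are continuous. $f^a=\{x\in X\mid f(x)\le a\}$. $f$ is a Lyapunov function for $\varphi$ if $f(\varphi(x))<f(x)$ whenever $x$ is not a fixed point of $\varphi$. Condition (D): for $Y\subset X$, $(f,\varphi)$ satisfies condition (D) on $Y$ if $f$ is a Lyapunov function for $\varphi$ and: if $A\subset Y$ is a subset on which $|f|$ is bounded but on which $f(y)-f(\varphi(y))$ is not bounded away from zero, then there is a fixed point of $\varphi$ in the closure of $A$. Index function: an index function on $X$ is a function $\nu\colon 2^X\times 2^X\to\mathbb{N}\cup\{0\}$ satisfying (monotonicity) if $A\subset B$ then $\nu(A,Y)\le\nu(B,Y)$ for all $Y\subset X$; (continuity) for every closed $A\subset X$ there is a neighborhood $U$ of $A$ such that $\nu(A,Y)=\nu(U,Y)$ for all $Y\subset X$; (mixed subadditivity) $\nu(A\cup B,Y)\le\nu(A,Y)+\nu(B,\emptyset)$ for all $A,B,Y\subset X$. One writes $\nu(A)$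 for $\nu(A,\emptyset)$. Given $\varphi\colon X\to X$ and $Z\subset X$, the index function $\nu$ is $(\varphi,Z)$-supervariant if $\nu(\varphi(A),Z)\ge\nu(A,Z)$ for all $A\subset X$. *)

theory Defs
  imports "HOL-Analysis.Analysis"
begin

definition sublevel :: "('a \<Rightarrow> real) \<Rightarrow> real \<Rightarrow> 'a set" where
  "sublevel f a = {x. f x \<le> a}"

definition fixed_points :: "('a \<Rightarrow> 'a) \<Rightarrow> 'a set" where
  "fixed_points \<phi> = {x. \<phi> x = x}"

text \<open>Continuity of \<open>f\<close> and \<open>\<phi>\<close> is not part of the following definitions; it is assumed
  separately wherever they are used.\<close>

definition lyapunov_function :: "('a \<Rightarrow> real) \<Rightarrow> ('a \<Rightarrow> 'a) \<Rightarrow> bool" where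
  "lyapunov_function f \<phi> \<longleftrightarrow> (\<forall>x. x \<notin> fixed_points \<phi> \<longrightarrow> f (\<phi> x) < f x)"

definition bounded_away_from_zero_on :: "'a set \<Rightarrow> ('a \<Rightarrow> real) \<Rightarrow> bool" where
  "bounded_away_from_zero_on A g \<longleftrightarrow> (\<exists>\<epsilon>>0. \<forall>y\<in>A. \<bar>g y\<bar> \<ge> \<epsilon>)"

definition condition_D ::
    "('a::topological_space \<Rightarrow> real) \<Rightarrow> ('a \<Rightarrow> 'a) \<Rightarrow> 'a set \<Rightarrow> bool" where
  "condition_D f \<phi> Y \<longleftrightarrow>
     lyapunov_function f \<phi> \<and>
     (\<forall>A\<subseteq>Y. bounded (f ` A) \<and> \<not> bounded_away_from_zero_on A (\<lambda>y. f y - f (\<phi> y))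
        \<longrightarrow> fixed_points \<phi> \<inter> closure A \<noteq> {})"

text \<open>In the continuity axiom, a neighbourhood of \<open>A\<close> is any set, not necessarily open,
  whose interior contains \<open>A\<close>.\<close>

definition index_function :: "('a::topological_space set \<Rightarrow> 'a set \<Rightarrow> nat) \<Rightarrow> bool" where
  "index_function \<nu> \<longleftrightarrow>
     (\<forall>A B Y. A \<subseteq> B \<longrightarrow> \<nu> A Y \<le> \<nu> B Y) \<and>
     (\<forall>A. closed A \<longrightarrow> (\<exists>U. A \<subseteq> interior U \<and> (\<forall>Y. \<nu> A Y = \<nu> U Y))) \<and>
     (\<forall>A B Y. \<nu> (A \<union> B) Y \<le> \<nu> A Y + \<nu> B {})"

definition supervariant ::
    "('a set \<Rightarrow> 'a set \<Rightarrow> nat) \<Rightarrow> ('a \<Rightarrow> 'a) \<Rightarrow> 'a set \<Rightarrow> bool" where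
  "supervariant \<nu> \<phi> Z \<longleftrightarrow> (\<forall>A. \<nu> (\<phi> ` A) Z \<ge> \<nu> A Z)"

end

theory Submission
  imports Defs
begin

text \<open>The inequality is proved by continuous induction on the level. Write \<open>Z\<close> for \<open>f\<^sup>a\<close> and let
  \<open>P t\<close> say that \<open>\<nu> f\<^sup>t Z\<close> is at most \<open>\<nu> f\<^sup>a Z\<close> plus the indices of the fixed point sets at the
  critical levels in \<open>]a,t]\<close>. Away from a neighbourhood of the fixed points, condition (D) makes
  \<open>f\<close> drop by a uniform amount under \<open>\<phi>\<close> (\<open>uniform_drop\<close>). Near a given level \<open>t\<close> this has two
  consequences.

  From above (\<open>sublevel_pushed_into_neighbourhood\<close>): given a neighbourhood of \<open>f\<^sup>t\<close>, a single
  application of \<open>\<phi>\<close> carries some slightly higher sublevel into it. If the neighbourhood has the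
  same index as \<open>f\<^sup>t\<close>, supervariance shows that the index does not grow immediately above \<open>t\<close>.

  From below (\<open>sublevel_pushed_below\<close>): a single application of \<open>\<phi>\<close> carries \<open>f\<^sup>t\<close> into a strictly
  lower sublevel together with any prescribed neighbourhood of the fixed points at level \<open>t\<close>. By
  mixed subadditivity, the index at \<open>t\<close> exceeds that at some lower level by at most the index of
  these fixed points, and not at all if there are none.

  So the supremum \<open>s\<close> of the levels satisfying \<open>P\<close> satisfies \<open>P\<close> itself, and \<open>s < b\<close> is impossible.
  Working level by level in this way replaces the iteration of \<open>\<phi>\<close>, with a bound on the number of
  steps, that would flow a whole sublevel down to the next critical level.\<close>

lemma lyapunov_function_le:
  assumes "lyapunov_function f \<phi>"
  shows "f (\<phi> x) \<le> f x"
  using assms unfolding lyapunov_function_def fixed_points_def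
  by (metis (mono_tags, lifting) less_imp_le mem_Collect_eq order_refl)

text \<open>The part of the slab outside \<open>V\<close> is closed and contains no fixed point, so condition (D)
  cannot allow \<open>f y - f (\<phi> y)\<close> to be arbitrarily small on it.\<close>

lemma uniform_drop:
  fixes f :: "'a::topological_space \<Rightarrow> real"
  assumes f: "continuous_on UNIV f"
    and D: "condition_D f \<phi> (f -` {a..b})"
    and "a \<le> c" "e \<le> b"
    and V: "open V" "fixed_points \<phi> \<inter> f -` {c..e} \<subseteq> V"
  obtains \<epsilon> where "\<epsilon> > 0"
    and "\<And>x. c \<le> f x \<Longrightarrow> f x \<le> e \<Longrightarrow> x \<notin> V \<Longrightarrow> f (\<phi> x) \<le> f x - \<epsilon>"
proof -
  let ?A = "f -` {c..e} - V"
  have "closed (f -` {c..e})"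
    using f by (simp add: closed_vimage)
  then have "closed ?A"
    using V(1) by (rule closed_Diff)
  then have "fixed_points \<phi> \<inter> closure ?A = {}"
    using V(2) by auto
  moreover have "?A \<subseteq> f -` {a..b}"
    using assms(3,4) by auto
  moreover have "bounded (f ` ?A)"
    by (rule bounded_subset[OF bounded_closed_interval[of c e]]) auto
  ultimately have "bounded_away_from_zero_on ?A (\<lambda>y. f y - f (\<phi> y))"
    using D unfolding condition_D_def by blast
  then obtain \<epsilon> where "\<epsilon> > 0" and \<epsilon>: "\<And>y. y \<in> ?A \<Longrightarrow> \<epsilon> \<le> \<bar>f y - f (\<phi> y)\<bar>"
    unfolding bounded_away_from_zero_on_def by blast
  have le: "f (\<phi> x) \<le> f x" for x
    using D lyapunov_function_le unfolding condition_D_def by metis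
  have "f (\<phi> x) \<le> f x - \<epsilon>" if "c \<le> f x" "f x \<le> e" "x \<notin> V" for x
    using \<epsilon>[of x] le[of x] that by auto
  with \<open>\<epsilon> > 0\<close> show thesis
    by (rule that)
qed

text \<open>A point slightly above level \<open>t\<close> either maps into \<open>W\<close> or drops uniformly; if it starts close
  enough to \<open>t\<close>, the drop puts it into \<open>f\<^sup>t \<subseteq> W\<close>. The uniform drop is applied outside the preimage
  of \<open>W\<close>, rather than outside \<open>W\<close>: points of \<open>W\<close> may leave \<open>W\<close> under \<open>\<phi>\<close>.\<close>

lemma sublevel_pushed_into_neighbourhood:
  fixes f :: "'a::topological_space \<Rightarrow> real"
  assumes \<phi>: "continuous_on UNIV \<phi>" and f: "continuous_on UNIV f"
    and D: "condition_D f \<phi> (f -` {a..b})"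
    and fin: "finite (f ` fixed_points \<phi> \<inter> {a<..b})"
    and t: "a \<le> t" "t < b"
    and W: "open W" "sublevel f t \<subseteq> W"
  obtains u where "t < u" "u \<le> b" "\<phi> ` sublevel f u \<subseteq> W"
proof -
  obtain \<delta> where "\<delta> > 0" and \<delta>: "\<forall>x \<in> f ` fixed_points \<phi> \<inter> {a<..b}. x \<noteq> t \<longrightarrow> \<delta> \<le> dist t x"
    using finite_set_avoid[OF fin] by blast
  define e where "e = min b (t + \<delta> / 2)"
  have e: "t < e" "e \<le> b"
    using \<open>\<delta> > 0\<close> t by (auto simp: e_def)
  have le: "f (\<phi> x) \<le> f x" for x
    using D lyapunov_function_le unfolding condition_D_def by metis
  have below: "\<phi> x \<in> W" if "f x \<le> t" for x
    using W(2) le[of x] that by (auto simp: sublevel_def)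
  have "open (\<phi> -` W)"
    using \<phi> W(1) by (simp add: open_vimage)
  moreover have "fixed_points \<phi> \<inter> f -` {t..e} \<subseteq> \<phi> -` W"
  proof
    fix x assume x: "x \<in> fixed_points \<phi> \<inter> f -` {t..e}"
    have "f x = t"
    proof (rule ccontr)
      assume "f x \<noteq> t"
      with x t e have "f x \<in> f ` fixed_points \<phi> \<inter> {a<..b}" "t < f x" "f x \<le> e"
        by auto
      with \<delta> \<open>f x \<noteq> t\<close> have "\<delta> \<le> dist t (f x)"
        by blast
      with \<open>t < f x\<close> \<open>f x \<le> e\<close> \<open>\<delta> > 0\<close> show False
        by (auto simp: dist_real_def e_def)
    qed
    then show "x \<in> \<phi> -` W"
      using below by simp
  qed
  ultimately obtain \<epsilon> where "\<epsilon> > 0"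
    and \<epsilon>: "\<And>x. t \<le> f x \<Longrightarrow> f x \<le> e \<Longrightarrow> x \<notin> \<phi> -` W \<Longrightarrow> f (\<phi> x) \<le> f x - \<epsilon>"
    using uniform_drop[OF f D t(1) e(2)] by metis
  have "\<phi> ` sublevel f (min e (t + \<epsilon>)) \<subseteq> W"
  proof
    fix y assume "y \<in> \<phi> ` sublevel f (min e (t + \<epsilon>))"
    then obtain x where x: "y = \<phi> x" "f x \<le> e" "f x \<le> t + \<epsilon>"
      by (auto simp: sublevel_def)
    show "y \<in> W"
    proof (rule ccontr)
      assume "y \<notin> W"
      then have "t < f x"
        using below x(1) not_le by blast
      with \<open>y \<notin> W\<close> x have "f (\<phi> x) \<le> t"
        using \<epsilon>[of x] by auto
      with \<open>y \<notin> W\<close> x(1) W(2) show False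
        by (auto simp: sublevel_def)
    qed
  qed
  then show thesis
    using that[of "min e (t + \<epsilon>)"] e \<open>\<epsilon> > 0\<close> by auto
qed

text \<open>Because critical levels do not accumulate, the only fixed points just below or at level \<open>t\<close>
  are those at \<open>t\<close>, which map into \<open>W\<close>; all other points there drop uniformly. The set \<open>W\<close> may be
  empty, which is the case of a level that is not critical.\<close>

lemma sublevel_pushed_below:
  fixes f :: "'a::topological_space \<Rightarrow> real"
  assumes \<phi>: "continuous_on UNIV \<phi>" and f: "continuous_on UNIV f"
    and D: "condition_D f \<phi> (f -` {a..b})"
    and fin: "finite (f ` fixed_points \<phi> \<inter> {a<..b})"
    and t: "a < t" "t \<le> b"
    and W: "open W" "fixed_points \<phi> \<inter> f -` {t} \<subseteq> W"
  obtains u where "a \<le> u" "u < t" "\<phi> ` sublevel f t \<subseteq> sublevel f u \<union> W"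
proof -
  obtain \<delta> where "\<delta> > 0" and \<delta>: "\<forall>x \<in> f ` fixed_points \<phi> \<inter> {a<..b}. x \<noteq> t \<longrightarrow> \<delta> \<le> dist t x"
    using finite_set_avoid[OF fin] by blast
  \<comment> \<open>The slab must start strictly above \<open>a\<close>, since there may be fixed points at level \<open>a\<close>
    itself and these need not lie in \<open>W\<close>.\<close>
  define c where "c = max ((a + t) / 2) (t - \<delta> / 2)"
  have c: "a < c" "c < t"
    using \<open>\<delta> > 0\<close> t by (auto simp: c_def max_def)
  have le: "f (\<phi> x) \<le> f x" for x
    using D lyapunov_function_le unfolding condition_D_def by metis
  have "open (\<phi> -` W)"
    using \<phi> W(1) by (simp add: open_vimage)
  moreover have "fixed_points \<phi> \<inter> f -` {c..t} \<subseteq> \<phi> -` W"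
  proof
    fix x assume x: "x \<in> fixed_points \<phi> \<inter> f -` {c..t}"
    have "f x = t"
    proof (rule ccontr)
      assume "f x \<noteq> t"
      with x t c have "f x \<in> f ` fixed_points \<phi> \<inter> {a<..b}" "f x < t" "c \<le> f x"
        by auto
      with \<delta> \<open>f x \<noteq> t\<close> have "\<delta> \<le> dist t (f x)"
        by blast
      with \<open>f x < t\<close> \<open>c \<le> f x\<close> \<open>\<delta> > 0\<close> show False
        by (auto simp: dist_real_def c_def)
    qed
    with x W(2) have "x \<in> W"
      by auto
    with x show "x \<in> \<phi> -` W"
      by (simp add: fixed_points_def)
  qed
  ultimately obtain \<epsilon> where "\<epsilon> > 0"
    and \<epsilon>: "\<And>x. c \<le> f x \<Longrightarrow> f x \<le> t \<Longrightarrow> x \<notin> \<phi> -` W \<Longrightarrow> f (\<phi> x) \<le> f x - \<epsilon>"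
    using uniform_drop[OF f D less_imp_le[OF c(1)] t(2)] by metis
  have "\<phi> x \<in> sublevel f (max c (t - \<epsilon>)) \<union> W" if "f x \<le> t" for x
  proof (cases "c \<le> f x")
    case True
    then show ?thesis
      using \<epsilon>[of x] that by (auto simp: sublevel_def)
  next
    case False
    then show ?thesis
      using le[of x] by (auto simp: sublevel_def)
  qed
  then have "\<phi> ` sublevel f t \<subseteq> sublevel f (max c (t - \<epsilon>)) \<union> W"
    by (auto simp: sublevel_def)
  then show thesis
    using that[of "max c (t - \<epsilon>)"] c \<open>\<epsilon> > 0\<close> by auto
qed

theorem theorem2p3:
  fixes \<phi> :: "'a::t2_space \<Rightarrow> 'a"
    and f :: "'a \<Rightarrow> real"
    and a b :: real
    and \<nu> :: "'a set \<Rightarrow> 'a set \<Rightarrow> nat"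
  assumes "continuous_on UNIV \<phi>"
    and "continuous_on UNIV f"
    and "lyapunov_function f \<phi>"
    and "a < b"
    and "condition_D f \<phi> (f -` {a..b})"
    and "finite (f ` fixed_points \<phi> \<inter> {a<..b})"
    and "index_function \<nu>"
    and "supervariant \<nu> \<phi> (sublevel f a)"
  shows "\<nu> (sublevel f a) (sublevel f a)
           + (\<Sum>d \<in> f ` fixed_points \<phi> \<inter> {a<..b}. \<nu> (fixed_points \<phi> \<inter> f -` {d}) {})
         \<ge> \<nu> (sublevel f b) (sublevel f a)"
proof -
  let ?Z = "sublevel f a"
  define g where "g t = \<nu> (sublevel f t) ?Z" for t
  define C where "C t = f ` fixed_points \<phi> \<inter> {a<..t}" for t
  define h where "h d = \<nu> (fixed_points \<phi> \<inter> f -` {d}) {}" for d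
  define P where "P t \<longleftrightarrow> g t \<le> g a + sum h (C t)" for t
  note push = assms(1,2,5,6)
  have mono: "\<And>A B Y. A \<subseteq> B \<Longrightarrow> \<nu> A Y \<le> \<nu> B Y"
    and cont: "\<And>A. closed A \<Longrightarrow> \<exists>U. A \<subseteq> interior U \<and> (\<forall>Y. \<nu> A Y = \<nu> U Y)"
    and subadd: "\<And>A B Y. \<nu> (A \<union> B) Y \<le> \<nu> A Y + \<nu> B {}"
    using assms(7) unfolding index_function_def by auto
  have super: "\<nu> A ?Z \<le> \<nu> (\<phi> ` A) ?Z" for A
    using assms(8) unfolding supervariant_def by auto
  have g_mono: "g t \<le> g u" if "t \<le> u" for t u
    unfolding g_def by (rule mono) (use that in \<open>auto simp: sublevel_def\<close>)
  have fin: "finite (C t)" if "t \<le> b" for t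
    by (rule finite_subset[OF _ assms(6)]) (use that in \<open>auto simp: C_def\<close>)
  have sum_C_mono: "sum h (C t) \<le> sum h (C u)" if "t \<le> u" "u \<le> b" for t u
    by (rule sum_mono2) (use that fin in \<open>auto simp: C_def\<close>)
  have closed_f: "closed (f -` T)" if "closed T" for T
    using assms(2) that by (simp add: closed_vimage)
  have closed_F: "closed (fixed_points \<phi>)"
    unfolding fixed_points_def using assms(1) by (intro closed_Collect_eq) auto

  have no_growth_above: "\<exists>u. t < u \<and> u \<le> b \<and> g u \<le> g t" if t: "a \<le> t" "t < b" for t
  proof -
    have "sublevel f t = f -` {..t}"
      by (auto simp: sublevel_def)
    then obtain U where U: "sublevel f t \<subseteq> interior U" "\<And>Y. \<nu> (sublevel f t) Y = \<nu> U Y"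
      using cont[of "sublevel f t"] closed_f by fastforce
    obtain u where "t < u" "u \<le> b" and u: "\<phi> ` sublevel f u \<subseteq> interior U"
      using sublevel_pushed_into_neighbourhood[OF push t open_interior U(1)] .
    have "g u \<le> \<nu> (\<phi> ` sublevel f u) ?Z"
      unfolding g_def by (rule super)
    also have "\<dots> \<le> \<nu> U ?Z"
      using u interior_subset by (intro mono) blast
    also have "\<dots> = g t"
      using U(2) by (simp add: g_def)
    finally show ?thesis
      using \<open>t < u\<close> \<open>u \<le> b\<close> by blast
  qed

  \<comment> \<open>The noncritical case is separate because the axioms allow \<open>\<nu> {} {} > 0\<close>.\<close>
  have growth_below: "\<exists>u. a \<le> u \<and> u < t \<and> g t \<le> g u + (if t \<in> C b then h t else 0)"
    if t: "a < t" "t \<le> b" for t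
  proof (cases "t \<in> C b")
    case True
    have "closed (fixed_points \<phi> \<inter> f -` {t})"
      using closed_F closed_f by (intro closed_Int) auto
    then obtain U where U: "fixed_points \<phi> \<inter> f -` {t} \<subseteq> interior U"
        "\<And>Y. \<nu> (fixed_points \<phi> \<inter> f -` {t}) Y = \<nu> U Y"
      using cont by blast
    obtain u where "a \<le> u" "u < t" and u: "\<phi> ` sublevel f t \<subseteq> sublevel f u \<union> interior U"
      using sublevel_pushed_below[OF push t open_interior U(1)] .
    have "g t \<le> \<nu> (\<phi> ` sublevel f t) ?Z"
      unfolding g_def by (rule super)
    also have "\<dots> \<le> \<nu> (sublevel f u \<union> U) ?Z"
      using u interior_subset by (intro mono) blast
    also have "\<dots> \<le> g u + h t"
      using subadd[of "sublevel f u" U ?Z] U(2) by (simp add: g_def h_def)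
    finally show ?thesis
      using \<open>a \<le> u\<close> \<open>u < t\<close> True by auto
  next
    case False
    then have "fixed_points \<phi> \<inter> f -` {t} \<subseteq> {}"
      using t by (auto simp: C_def)
    then obtain u where "a \<le> u" "u < t" and u: "\<phi> ` sublevel f t \<subseteq> sublevel f u \<union> {}"
      using sublevel_pushed_below[OF push t open_empty] by blast
    have "g t \<le> \<nu> (\<phi> ` sublevel f t) ?Z"
      unfolding g_def by (rule super)
    also have "\<dots> \<le> g u"
      using u unfolding g_def by (intro mono) simp
    finally show ?thesis
      using \<open>a \<le> u\<close> \<open>u < t\<close> False by auto
  qed

  define S where "S = {t. a \<le> t \<and> t \<le> b \<and> P t}"
  define s where "s = Sup S"
  have "a \<in> S"
    using assms(4) by (simp add: S_def P_def)
  have bdd: "bdd_above S"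
    by (rule bdd_aboveI[of _ b]) (simp add: S_def)
  have "a \<le> s"
    unfolding s_def using \<open>a \<in> S\<close> bdd by (rule cSup_upper)
  have "S \<noteq> {}"
    using \<open>a \<in> S\<close> by blast
  then have "s \<le> b"
    unfolding s_def by (rule cSup_least) (simp add: S_def)
  note s = \<open>a \<le> s\<close> \<open>s \<le> b\<close>
  have "P s"
  proof (cases "s \<in> S")
    case True
    then show ?thesis
      by (simp add: S_def)
  next
    case False
    with \<open>a \<in> S\<close> s have "a < s"
      by (cases "a = s") auto
    then obtain u where u: "a \<le> u" "u < s" "g s \<le> g u + (if s \<in> C b then h s else 0)"
      using growth_below s by blast
    obtain t where t: "t \<in> S" "u < t"
      using less_cSupD[OF \<open>S \<noteq> {}\<close>] u(2) unfolding s_def by blast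
    have "t \<le> s"
      unfolding s_def using t(1) bdd by (rule cSup_upper)
    with t(1) False have "t < s"
      by (cases "t = s") auto
    have "g u \<le> g a + sum h (C t)"
      using g_mono[of u t] t by (simp add: S_def P_def)
    moreover have "sum h (C t) + (if s \<in> C b then h s else 0) \<le> sum h (C s)"
    proof (cases "s \<in> C b")
      case True
      have "s \<notin> C t"
        using \<open>t < s\<close> by (simp add: C_def)
      then have "sum h (C t) + h s = sum h (insert s (C t))"
        using fin[of t] t(1) by (simp add: S_def)
      also have "\<dots> \<le> sum h (C s)"
        by (rule sum_mono2) (use fin[OF s(2)] True \<open>t < s\<close> in \<open>auto simp: C_def\<close>)
      finally show ?thesis
        using True by simp
    next
      case False
      then show ?thesis
        using sum_C_mono[of t s] \<open>t < s\<close> s(2) by simp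
    qed
    ultimately show ?thesis
      using u(3) by (simp add: P_def)
  qed
  have "s = b"
  proof (rule ccontr)
    assume "s \<noteq> b"
    then obtain u where u: "s < u" "u \<le> b" "g u \<le> g s"
      using no_growth_above[of s] s by auto
    then have "P u"
      using \<open>P s\<close> sum_C_mono[of s u] by (simp add: P_def)
    then have "u \<in> S"
      using u s by (simp add: S_def)
    then have "u \<le> s"
      unfolding s_def using bdd by (rule cSup_upper)
    with u(1) show False
      by simp
  qed
  with \<open>P s\<close> show ?thesis
    by (simp add: P_def g_def C_def h_def)
qed

end
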